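(* If $\ell$, $m$, and $n$ are non-negative integers, then $$\sum_{k=0}^\infty \frac{(-1)^k}{k!^3}\,\frac{\left(\frac12\right)_k^3\,(4k+1-2\ell)}{\prod_{j=1}^{\ell}(2k-2j+1)\,\prod_{j=1}^{m}(2k-2j+1)\,\prod_{j=1}^{n}(2k-2j+1)\,\prod_{j=1}^{m-\ell}(k+j)\,\prod_{j=1}^{n-\ell}(k+j)} = \frac{(-1)^{m+n}}{\left(\frac12\right)_m\left(\frac12\right)_n\left(\frac12\right)_{m+n-\ell}\,2^{\ell+m+n-1}}\,\frac1\pi.$$ In particular, $$\sum_{k=0}^\infty (-1)^k\frac{\left(\frac12\right)_k^3}{k!^3}\,\frac{4k+1}{\prod_{j=1}^n(2k-2j+1)(k+j)}=\frac{(-1)^n}{\left(\frac12\right)_n^2\,2^{n-1}}\,\frac1\pi,$$ $$\sum_{k=0}^\infty (-1)^k\frac{\left(\frac12\right)_k^3}{k!^3}\,\frac{4k+1-2n}{\prod_{j=1}^n(2k-2j+1)^3}=\frac{1}{\left(\frac12\right)_n^3\,2^{3n-1}}\,\frac1\pi,$$ $$\sum_{k=0}^\infty (-1)^k\frac{\left(\frac12\right)_k^3}{k!^3}\,\frac{4k+1-2m}{\prod_{j=1}^m(2k-2j+1)^2\,\prod_{j=1}^n(2k-2j+1)\,\prod_{j=1}^{n-m}(k+j)}=\frac{(-1)^{m+n}}{\left(\frac12\right)_m\left(\frac12\right)_n^2\,2^{2m+n-1}}\,\frac1\pi,$$ and $$\sum_{k=0}^\infty (-1)^k\frac{\left(\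frac12\right)_k^3}{k!^3}\,\frac{4k+1-2\ell}{\prod_{j=1}^\ell(2k-2j+1)\,\prod_{j=1}^n(2k-2j+1)^2\,\prod_{j=1}^{n-\ell}(k+j)^2}=\frac{1}{\left(\frac12\right)_{2n-\ell}\left(\frac12\right)_n^2\,2^{2n+\ell-1}}\,\frac1\pi.$$
   Context: For complex $x$, $(x)_y=\Gamma(x+y)/\Gamma(x)$, where $\Gamma$ is Euler's Gamma function; for a non-negative integer $n$ this is the Pochhammer symbol $(x)_n=\prod_{j=0}^{n-1}(x+j)$. A product over $j$ from $1$ to $0$ equals $1$. In $\prod_{j=1}^n(2k-2j+1)(k+j)$ the product extends over both factors.
   Formalization: Adds ℓ ≤ 2m+2n in the main identity and ℓ ≤ 4n in the last one, since otherwise the series diverges (e.g. ℓ=1, m=n=0); products over k+j with negative upper limit N are read as (k+1)_N = Γ(k+1+N)/Γ(k+1), with reciprocal 0 at poles. *)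

theory Defs
  imports "HOL-Analysis.Analysis"
begin

text \<open>
  The symbol \<open>(x)\<^sub>y = \<Gamma>(x + y) / \<Gamma>(x)\<close>. It is needed for indices that may be negative
  integers; for natural indices it is \<^const>\<open>pochhammer\<close> (lemma \<open>gen_pochhammer_of_nat\<close>).
\<close>

definition gen_pochhammer :: "'a::Gamma \<Rightarrow> 'a \<Rightarrow> 'a" where
  "gen_pochhammer x y = Gamma (x + y) / Gamma x"

lemma gen_pochhammer_of_nat:
  assumes "x \<notin> \<int>\<^sub>\<le>\<^sub>0"
  shows "gen_pochhammer x (of_nat n) = pochhammer x n"
  using assms by (simp add: gen_pochhammer_def pochhammer_Gamma)

text \<open>
  The product of \<open>f j\<close> for \<open>j\<close> from 1 to \<open>N\<close>, where \<open>N\<close> may be negative: the usual convention,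
  forced by \<open>prod_upto f N = prod_upto f (N - 1) * f N\<close>. If a factor vanishes for negative \<open>N\<close>,
  the product is infinite and its reciprocal is 0; since \<open>inverse 0 = 0\<close>, a quotient
  \<open>c / prod_upto f N\<close> has exactly this value (lemma \<open>divide_prod_upto_neg\<close>). Hence
  \<open>1 / (\<Prod>j=1..N. k + j) = \<Gamma>(k + 1) / \<Gamma>(k + 1 + N)\<close>, with the entire function \<open>1 / \<Gamma>\<close>,
  for all integers \<open>N\<close> (lemma \<open>inverse_prod_upto_plus\<close>).
\<close>

definition prod_upto :: "(int \<Rightarrow> 'a::field) \<Rightarrow> int \<Rightarrow> 'a" where
  "prod_upto f N = (if 0 \<le> N then \<Prod>j=1..N. f j else inverse (\<Prod>j=N+1..0. f j))"

lemma prod_upto_of_nat: "prod_upto f (int n) = (\<Prod>j=1..n. f (int j))"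
proof -
  have "(\<Prod>j\<in>int ` {1..n}. f j) = (\<Prod>j=1..n. f (int j))"
    by (subst prod.reindex) auto
  moreover have "int ` {1..n} = {1..int n}"
    by (simp add: image_int_atLeastAtMost)
  ultimately show ?thesis by (simp add: prod_upto_def)
qed

lemma divide_prod_upto_neg:
  assumes "N < 0"
  shows "c / prod_upto f N = c * (\<Prod>j=N+1..0. f j)"
  using assms by (simp add: prod_upto_def divide_inverse)

lemma inverse_prod_upto_plus:
  "1 / prod_upto (\<lambda>j. real k + of_int j) N = Gamma (real k + 1) * rGamma (real k + 1 + of_int N)"
proof (cases "0 \<le> N")
  case True
  then obtain n where N: "N = int n" by (metis nonneg_int_cases)
  have "prod_upto (\<lambda>j. real k + of_int j) N = pochhammer (real k + 1) n"
    unfolding N prod_upto_of_nat pochhammer_prod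
    by (rule prod.reindex_bij_witness[of _ Suc "\<lambda>j. j - 1"]) auto
  also have "\<dots> = Gamma (real k + 1 + real n) / Gamma (real k + 1)"
    by (rule pochhammer_Gamma) (auto elim!: nonpos_Ints_cases)
  finally show ?thesis
    by (simp add: N rGamma_inverse_Gamma divide_inverse)
next
  case False
  then obtain n where N: "N = - int n"
    by (metis int_cases2 of_nat_0_le_iff)
  let ?y = "real k + 1 - real n"
  have "(\<Prod>j=N+1..0. real k + of_int j) = pochhammer ?y n"
    unfolding pochhammer_prod N
    by (rule prod.reindex_bij_witness[of _ "\<lambda>i. int i - int n + 1" "\<lambda>j. nat (j + int n - 1)"])
      auto
  moreover have "rGamma ?y = pochhammer ?y n * rGamma (?y + real n)"
    by (rule pochhammer_rGamma)
  moreover have "Gamma (real k + 1) * rGamma (real k + 1) = 1"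
    using Gamma_fact[of k, where ?'a = real] by (simp add: rGamma_inverse_Gamma add.commute)
  ultimately show ?thesis
    using False by (simp add: divide_prod_upto_neg N algebra_simps)
qed

end

theory Submission
  imports Defs "HOL-Real_Asymp.Real_Asymp"
begin

text \<open>
  Every series in the theorem is a case of one summation formula for a well-poised series at
  \<open>-1\<close> with three real parameters. In classical notation it is the sum of
  \<open>\<^sub>4F\<^sub>3(a, 1 + a/2, b, c; a/2, 1 + a - b, 1 + a - c; -1)\<close>; multiplied by
  \<open>a / (\<Gamma>(1 + a - b) \<Gamma>(1 + a - c))\<close>, so that no pole remains, it reads
  \<open>(\<Sum>k. (-1)^k (a)\<^sub>k (b)\<^sub>k (c)\<^sub>k (2k + a) / (k! \<Gamma>(1 + a - b + k) \<Gamma>(1 + a - c + k)))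
  = 1 / (\<Gamma>(a) \<Gamma>(1 + a - b - c))\<close> for \<open>2b + 2c - a < 2\<close>,
  which is \<open>well_poised_sum\<close>. The choice \<open>a = 1/2 - l\<close>, \<open>b = 1/2 - m\<close>,
  \<open>c = 1/2 - n\<close> turns \<open>(b)\<^sub>k\<close>, up to a constant factor, into \<open>(1/2)\<^sub>k\<close>
  divided by a product of \<open>m\<close> odd numbers (\<open>pochhammer_half_div_prod_odd\<close>; \<open>(a)\<^sub>k\<close> and \<open>(c)\<^sub>k\<close>
  likewise) and the reciprocals of \<open>\<Gamma>\<close> into the products of
  the factors \<open>k + j\<close>. The convergence condition becomes \<open>l \<le> 2m + 2n\<close>, with conditional
  convergence at equality, and the factor \<open>1/\<pi>\<close> is \<open>1 / \<Gamma>(1/2)\<^sup>2\<close>.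

  The formula itself is proved by moving \<open>a\<close> to infinity. Both sides satisfy
  \<open>R(a) = a (1 + a - b - c) R(a + 1)\<close>: on the right this is the functional equation of
  \<open>\<Gamma>\<close>, on the left the difference of the summands is a telescoping difference in \<open>k\<close>
  (\<open>well_poised_coeff_telescope\<close>) whose boundary term tends to 0. The same telescoping carries
  convergence from \<open>a + 1\<close> down to \<open>a\<close>, so that only large \<open>a\<close>, where convergence is
  absolute, has to be treated directly. There, after division by its summand at \<open>k = 0\<close>, the
  series tends to 1, since the quotients, for large \<open>a\<close>, decrease in absolute value and those with
  \<open>k > 0\<close> tend to 0
  (\<open>suminf_well_poised_ratio_tendsto\<close>). The growth of the Gamma factors then fixes the value.
\<close>

section \<open>Growth of Pochhammer symbols and of the reciprocal Gamma function\<close>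

lemma pochhammer_asymptotics:
  fixes x :: real
  shows "(\<lambda>k. pochhammer x k / (fact k * real k powr (x - 1))) \<longlonglongrightarrow> rGamma x"
proof -
  have "(\<lambda>k. rGamma_series x k * (real k / (x + real k))) \<longlonglongrightarrow> rGamma x * 1"
    by (intro tendsto_mult rGamma_series_LIMSEQ) real_asymp
  moreover have "\<forall>\<^sub>F k in sequentially. rGamma_series x k * (real k / (x + real k)) =
      pochhammer x k / (fact k * real k powr (x - 1))"
  proof -
    have "\<forall>\<^sub>F k in sequentially. real k > \<bar>x\<bar>"
      by real_asymp
    then show ?thesis
    proof eventually_elim
      case (elim k)
      then have "real k powr x = real k powr (x - 1) * real k"
        by (simp add: powr_diff)
      moreover have "x + real k \<noteq> 0" "real k > 0"
        using elim by linarith+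
      ultimately show ?case
        by (simp add: rGamma_series_def pochhammer_Suc powr_def)
    qed
  qed
  ultimately show ?thesis
    by (auto dest: Lim_transform_eventually)
qed

text \<open>
  For \<open>z > 0\<close> this is the previous lemma, since
  \<open>rGamma (z + k) = rGamma z / pochhammer z k\<close>. At a pole of \<open>\<Gamma>\<close> that
  quotient is \<open>0 / 0\<close> for large \<open>k\<close>, so smaller \<open>z\<close> are reached by the functional equation, one unit at a time.
\<close>

lemma rGamma_shift_asymptotics:
  fixes z :: real
  shows "(\<lambda>k. rGamma (z + real k) * (fact k * real k powr (z - 1))) \<longlonglongrightarrow> 1"
proof -
  have pos: "(\<lambda>k. rGamma (z + real k) * (fact k * real k powr (z - 1))) \<longlonglongrightarrow> 1"
    if "z > 0" for z :: real
  proof -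
    have "rGamma z \<noteq> 0"
      using that by (auto simp: rGamma_eq_zero_iff elim: nonpos_Ints_cases)
    then have "(\<lambda>k. rGamma z / (pochhammer z k / (fact k * real k powr (z - 1))))
        \<longlonglongrightarrow> rGamma z / rGamma z"
      by (intro tendsto_divide tendsto_const pochhammer_asymptotics)
    moreover have "rGamma z / (pochhammer z k / (fact k * real k powr (z - 1))) =
        rGamma (z + real k) * (fact k * real k powr (z - 1))" for k
      using pochhammer_pos[OF that, of k] by (subst pochhammer_rGamma[of z k]) simp
    ultimately show ?thesis
      using \<open>rGamma z \<noteq> 0\<close> by simp
  qed
  have "\<forall>z>- real p. (\<lambda>k. rGamma (z + real k) * (fact k * real k powr (z - 1))) \<longlonglongrightarrow> 1"
    for p
  proof (induction p)
    case 0
    then show ?case using pos by simp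
  next
    case (Suc p)
    show ?case
    proof (intro allI impI)
      fix z :: real
      assume "z > - real (Suc p)"
      then have "z + 1 > - real p"
        by simp
      with Suc.IH have "(\<lambda>k. rGamma (z + 1 + real k) * (fact k * real k powr (z + 1 - 1))) \<longlonglongrightarrow> 1"
        by blast
      then have "(\<lambda>k. rGamma (z + 1 + real k) * (fact k * real k powr (z + 1 - 1)) *
          ((z + real k) / real k)) \<longlonglongrightarrow> 1 * 1"
        by (rule tendsto_mult) real_asymp
      moreover have "\<forall>\<^sub>F k in sequentially. rGamma (z + 1 + real k) *
          (fact k * real k powr (z + 1 - 1)) * ((z + real k) / real k) =
          rGamma (z + real k) * (fact k * real k powr (z - 1))"
        using eventually_gt_at_top[of 0]
      proof eventually_elim
        case (elim k)
        have "rGamma (z + real k) = (z + real k) * rGamma (z + 1 + real k)"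
          using rGamma_plus1[of "z + real k"] by (simp add: algebra_simps)
        with elim show ?case
          by (simp add: powr_diff)
      qed
      ultimately show "(\<lambda>k. rGamma (z + real k) * (fact k * real k powr (z - 1))) \<longlonglongrightarrow> 1"
        by (auto dest: Lim_transform_eventually)
    qed
  qed
  moreover obtain p :: nat where "z > - real p"
    using reals_Archimedean2[of "- z"] by (auto simp: minus_less_iff)
  ultimately show ?thesis by blast
qed

lemma powr_minus_2_eq:
  assumes "x > (0::real)"
  shows "x powr (y - 2) = x powr (y - 3) * x"
  using assms powr_add[of x "y - 3" 1] by simp

section \<open>The telescoping relation in the first parameter\<close>

text \<open>
  The summand of the well-poised series without its linear factor \<open>2 k + a\<close>. The reciprocal
  Gamma function replaces the lower parameters \<open>1 + a - b\<close> and \<open>1 + a - c\<close>, so that these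
  may be non-positive integers.
\<close>

definition well_poised_coeff :: "real \<Rightarrow> real \<Rightarrow> real \<Rightarrow> nat \<Rightarrow> real" where
  "well_poised_coeff a b c k = (-1) ^ k * pochhammer a k * pochhammer b k * pochhammer c k / fact k *
     rGamma (1 + a - b + real k) * rGamma (1 + a - c + real k)"

lemma well_poised_coeff_asymptotics:
  "(\<lambda>k. (-1) ^ k * well_poised_coeff a b c k / real k powr (2 * b + 2 * c - a - 3))
     \<longlonglongrightarrow> rGamma a * rGamma b * rGamma c"
proof -
  let ?P = "\<lambda>x k. pochhammer x k / (fact k * real k powr (x - 1))"
  let ?Q = "\<lambda>z k. rGamma (z + real k) * (fact k * real k powr (z - 1))"
  have "(\<lambda>k. ?P a k * ?P b k * ?P c k * ?Q (1 + a - b) k * ?Q (1 + a - c) k)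
     \<longlonglongrightarrow> rGamma a * rGamma b * rGamma c * 1 * 1"
    by (intro tendsto_mult pochhammer_asymptotics rGamma_shift_asymptotics)
  moreover have "\<forall>\<^sub>F k in sequentially.
      ?P a k * ?P b k * ?P c k * ?Q (1 + a - b) k * ?Q (1 + a - c) k =
      (-1) ^ k * well_poised_coeff a b c k / real k powr (2 * b + 2 * c - a - 3)"
    using eventually_gt_at_top[of 0]
  proof eventually_elim
    case (elim k)
    have e: "real k powr (2 * b + 2 * c - a - 3) =
        real k powr (a - 1) * real k powr (b - 1) * real k powr (c - 1) /
        (real k powr (1 + a - b - 1) * real k powr (1 + a - c - 1))"
      by (simp flip: powr_add powr_diff add: algebra_simps)
    have regroup: "P / (F * A) * (Q / (F * B)) * (R / (F * C)) * (u * (F * D)) * (v * (F * E)) =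
        s * (s * P * Q * R / F * u * v) / (A * B * C / (D * E))"
      if "F \<noteq> 0" "s * s = 1" "A \<noteq> 0" "B \<noteq> 0" "C \<noteq> 0" "D \<noteq> 0" "E \<noteq> 0"
      for P Q R u v s F A B C D E :: real
    proof -
      have "s * (s * P * Q * R / F * u * v) / (A * B * C / (D * E)) =
          (s * s) * (P * Q * R / F * u * v) / (A * B * C / (D * E))"
        by simp
      also have "\<dots> = P / (F * A) * (Q / (F * B)) * (R / (F * C)) * (u * (F * D)) * (v * (F * E))"
        unfolding that(2) using that(1,3-) by (simp add: field_simps)
      finally show ?thesis by simp
    qed
    show ?case
      unfolding e well_poised_coeff_def
      by (rule regroup) (use elim in \<open>simp_all flip: power_mult_distrib\<close>)
  qed
  ultimately show ?thesis
    by (auto dest: Lim_transform_eventually)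
qed

lemma well_poised_coeff_summable:
  assumes "2 * b + 2 * c - a < 1"
  shows "summable (\<lambda>k. \<bar>well_poised_coeff a b c k * (2 * real k + a)\<bar>)"
proof (rule summable_comparison_test_bigo)
  let ?e = "2 * b + 2 * c - a - 2"
  show "summable (\<lambda>k. norm (real k powr ?e))"
    using assms by (simp add: summable_real_powr_iff)
  have "(\<lambda>k. (-1) ^ k * well_poised_coeff a b c k / real k powr (2 * b + 2 * c - a - 3) *
      ((2 * real k + a) / real k)) \<longlonglongrightarrow> (rGamma a * rGamma b * rGamma c) * 2"
    by (intro tendsto_mult well_poised_coeff_asymptotics) real_asymp
  then have "(\<lambda>k. \<bar>(-1) ^ k * well_poised_coeff a b c k / real k powr (2 * b + 2 * c - a - 3) *
      ((2 * real k + a) / real k)\<bar>) \<longlonglongrightarrow> \<bar>(rGamma a * rGamma b * rGamma c) * 2\<bar>"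
    by (rule tendsto_rabs)
  moreover have "\<forall>\<^sub>F k in sequentially.
      \<bar>(-1) ^ k * well_poised_coeff a b c k / real k powr (2 * b + 2 * c - a - 3) *
        ((2 * real k + a) / real k)\<bar> =
      \<bar>well_poised_coeff a b c k * (2 * real k + a)\<bar> / real k powr ?e"
    using eventually_gt_at_top[of 0]
  proof eventually_elim
    case (elim k)
    have "real k powr ?e = real k powr (2 * b + 2 * c - a - 3) * real k"
      using elim by (intro powr_minus_2_eq) simp
    with elim show ?case
      by (simp add: abs_mult power_abs)
  qed
  ultimately have "(\<lambda>k. \<bar>well_poised_coeff a b c k * (2 * real k + a)\<bar> / real k powr ?e) \<longlonglongrightarrow>
      \<bar>(rGamma a * rGamma b * rGamma c) * 2\<bar>"
    by (rule Lim_transform_eventually)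
  then show "(\<lambda>k. \<bar>well_poised_coeff a b c k * (2 * real k + a)\<bar>) \<in> O(\<lambda>k. real k powr ?e)"
    by (rule bigoI_tendsto) (use eventually_gt_at_top[of 0] in \<open>auto elim!: eventually_mono\<close>)
qed

text \<open>
  The boundary term of the telescoping sum. It is of order \<open>k powr (2 b + 2 c - a - 2)\<close>, and this
  is where the condition \<open>2 b + 2 c - a < 2\<close> comes from.
\<close>

lemma well_poised_coeff_times_index_tendsto_0:
  assumes "2 * b + 2 * c - a < 2"
  shows "(\<lambda>k. real k * well_poised_coeff a b c k) \<longlonglongrightarrow> 0"
proof -
  let ?X = "\<lambda>k. (-1) ^ k * well_poised_coeff a b c k / real k powr (2 * b + 2 * c - a - 3)"
  have "(\<lambda>k. real k powr (2 * b + 2 * c - a - 2)) \<longlonglongrightarrow> 0"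
    using assms by real_asymp
  then have "(\<lambda>k. ?X k * real k powr (2 * b + 2 * c - a - 2))
      \<longlonglongrightarrow> (rGamma a * rGamma b * rGamma c) * 0"
    by (intro tendsto_mult well_poised_coeff_asymptotics)
  moreover have "\<forall>\<^sub>F k in sequentially. ?X k * real k powr (2 * b + 2 * c - a - 2) =
      (-1) ^ k * (real k * well_poised_coeff a b c k)"
    using eventually_gt_at_top[of 0]
  proof eventually_elim
    case (elim k)
    have "real k powr (2 * b + 2 * c - a - 2) = real k powr (2 * b + 2 * c - a - 3) * real k"
      using elim by (intro powr_minus_2_eq) simp
    with elim show ?case by simp
  qed
  ultimately have "(\<lambda>k. (-1) ^ k * (real k * well_poised_coeff a b c k)) \<longlonglongrightarrow> 0"
    by (auto dest: Lim_transform_eventually)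
  then have "(\<lambda>k. \<bar>(-1) ^ k * (real k * well_poised_coeff a b c k)\<bar>) \<longlonglongrightarrow> 0"
    by (rule tendsto_rabs_zero)
  then have "(\<lambda>k. \<bar>real k * well_poised_coeff a b c k\<bar>) \<longlonglongrightarrow> 0"
    by (simp add: abs_mult power_abs)
  then show ?thesis
    by (rule tendsto_rabs_zero_cancel)
qed

text \<open>
  After the common factor of all four summands is removed, this is the polynomial identity
  \<open>(2k + a)(1 + a - b + k)(1 + a - c + k) - (1 + a - b - c)(a + k)(2k + a + 1) =
  k (1 + a - b + k)(1 + a - c + k) + (a + k)(b + k)(c + k)\<close>.
  The sign \<open>(-1) ^ k\<close> turns the sum on its right-hand side into a difference of consecutive values.
\<close>

lemma well_poised_coeff_telescope:
  "well_poised_coeff a b c k * (2 * real k + a) -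
     a * (1 + a - b - c) * (well_poised_coeff (a + 1) b c k * (2 * real k + (a + 1))) =
   real k * well_poised_coeff a b c k - real (Suc k) * well_poised_coeff a b c (Suc k)"
proof -
  define P where "P = (-1) ^ k * pochhammer b k * pochhammer c k / fact k"
  define R where "R = rGamma (2 + a - b + real k) * rGamma (2 + a - c + real k)"
  have rb: "rGamma (1 + a - b + real k) = (1 + a - b + real k) * rGamma (2 + a - b + real k)"
    using rGamma_plus1[of "1 + a - b + real k"] by (simp add: algebra_simps)
  have rc: "rGamma (1 + a - c + real k) = (1 + a - c + real k) * rGamma (2 + a - c + real k)"
    using rGamma_plus1[of "1 + a - c + real k"] by (simp add: algebra_simps)
  have 1: "well_poised_coeff a b c k =
      P * R * pochhammer a k * (1 + a - b + real k) * (1 + a - c + real k)"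
    unfolding well_poised_coeff_def rb rc P_def R_def by simp
  have pa: "a * pochhammer (a + 1) k = pochhammer a k * (a + real k)"
    by (metis pochhammer_rec pochhammer_Suc)
  have "well_poised_coeff (a + 1) b c k = P * R * pochhammer (a + 1) k"
    unfolding well_poised_coeff_def P_def R_def by (simp add: add_ac)
  then have 2: "a * well_poised_coeff (a + 1) b c k = P * R * pochhammer a k * (a + real k)"
    using pa by (simp add: mult_ac)
  have args: "1 + a - b + real (Suc k) = 2 + a - b + real k"
    "1 + a - c + real (Suc k) = 2 + a - c + real k"
    by simp_all
  have 3: "real (Suc k) * well_poised_coeff a b c (Suc k) =
      - (P * R * pochhammer a k * ((a + real k) * (b + real k) * (c + real k)))"
    unfolding well_poised_coeff_def args P_def R_def pochhammer_Suc fact_Suc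
    by (simp del: of_nat_Suc add: mult_ac)
  have "well_poised_coeff a b c k * (2 * real k + a) -
     a * (1 + a - b - c) * (well_poised_coeff (a + 1) b c k * (2 * real k + (a + 1))) =
     well_poised_coeff a b c k * (2 * real k + a) -
     (1 + a - b - c) * ((a * well_poised_coeff (a + 1) b c k) * (2 * real k + (a + 1)))"
    by (simp add: algebra_simps)
  also have "\<dots> = real k * well_poised_coeff a b c k - real (Suc k) * well_poised_coeff a b c (Suc k)"
    unfolding 2 unfolding 3 unfolding 1 by algebra
  finally show ?thesis .
qed

text \<open>
  Because the boundary term tends to 0, convergence passes from \<open>a + 1\<close> to \<open>a\<close>. This reaches the
  conditionally convergent cases, for which a comparison with powers of \<open>k\<close> is not enough.
\<close>

lemma well_poised_sums_step:
  assumes "2 * b + 2 * c - a < 2"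
  assumes "(\<lambda>k. well_poised_coeff (a + 1) b c k * (2 * real k + (a + 1))) sums S"
  shows "(\<lambda>k. well_poised_coeff a b c k * (2 * real k + a)) sums (a * (1 + a - b - c) * S)"
proof -
  have "(\<lambda>k. real k * well_poised_coeff a b c k - real (Suc k) * well_poised_coeff a b c (Suc k))
      sums (real 0 * well_poised_coeff a b c 0 - 0)"
    by (intro telescope_sums' well_poised_coeff_times_index_tendsto_0 assms)
  from sums_add[OF this[folded well_poised_coeff_telescope] sums_mult[OF assms(2), of "a * (1 + a - b - c)"]]
  show ?thesis
    by simp
qed

lemma well_poised_sums_shift:
  assumes "2 * b + 2 * c - a < 2"
  assumes "(\<lambda>k. well_poised_coeff (a + real N) b c k * (2 * real k + (a + real N))) sums S"
  shows "(\<lambda>k. well_poised_coeff a b c k * (2 * real k + a)) sums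
           (pochhammer a N * pochhammer (1 + a - b - c) N * S)"
  using assms
proof (induction N arbitrary: a)
  case (Suc N)
  have "(\<lambda>k. well_poised_coeff (a + 1) b c k * (2 * real k + (a + 1))) sums
      (pochhammer (a + 1) N * pochhammer (1 + (a + 1) - b - c) N * S)"
    using Suc.prems by (intro Suc.IH) (simp_all add: add_ac)
  from well_poised_sums_step[OF Suc.prems(1) this] show ?case
    by (simp add: pochhammer_rec algebra_simps)
qed simp

section \<open>The limit for a large first parameter\<close>

text \<open>
  The summand divided by the summand at \<open>k = 0\<close>. The product has the values of one
  rational function at \<open>a, a + 1, \<dots>\<close> as its factors, so that monotonicity and limit in \<open>a\<close> can be
  read off from that function.
\<close>

definition well_poised_ratio :: "real \<Rightarrow> real \<Rightarrow> real \<Rightarrow> nat \<Rightarrow> real" where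
  "well_poised_ratio a b c k = (-1) ^ k * pochhammer b k * pochhammer c k / fact k * (1 + 2 * real k / a) *
     (\<Prod>j<k. (a + real j) / ((1 - b + (a + real j)) * (1 - c + (a + real j))))"

lemma well_poised_coeff_eq_ratio:
  assumes "a > 0" "1 + a - b > 0" "1 + a - c > 0"
  shows "well_poised_coeff a b c k * (2 * real k + a) =
           a * rGamma (1 + a - b) * rGamma (1 + a - c) * well_poised_ratio a b c k"
proof -
  define B where "B = pochhammer (1 + a - b) k"
  define C where "C = pochhammer (1 + a - c) k"
  have "B > 0" "C > 0"
    unfolding B_def C_def using assms by (auto intro: pochhammer_pos)
  have "pochhammer a k = (\<Prod>j<k. a + real j)" "B = (\<Prod>j<k. 1 - b + (a + real j))"
    "C = (\<Prod>j<k. 1 - c + (a + real j))"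
    unfolding B_def C_def pochhammer_prod by (simp_all add: atLeast0LessThan algebra_simps)
  then have prod_eq: "(\<Prod>j<k. (a + real j) / ((1 - b + (a + real j)) * (1 - c + (a + real j)))) =
      pochhammer a k / (B * C)"
    by (simp add: prod_dividef prod.distrib)
  have rGamma_eq: "rGamma (1 + a - b) = B * rGamma (1 + a - b + real k)"
    "rGamma (1 + a - c) = C * rGamma (1 + a - c + real k)"
    unfolding B_def C_def by (rule pochhammer_rGamma)+
  show ?thesis
    using \<open>a > 0\<close> \<open>B > 0\<close> \<open>C > 0\<close>
    unfolding well_poised_coeff_def well_poised_ratio_def prod_eq rGamma_eq by (simp add: field_simps)
qed

text \<open>
  The map \<open>x \<mapsto> x / ((\<beta> + x) (\<gamma> + x))\<close> decreases once \<open>\<beta> + x\<close> and \<open>\<gamma> + x\<close>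
  are positive and \<open>x\<^sup>2 \<ge> \<beta> \<gamma>\<close>. Hence the ratios
  at one sufficiently large \<open>a\<close> dominate those at all larger ones, uniformly in \<open>k\<close>.
\<close>

lemma well_poised_ratio_antimono:
  assumes A: "a > 0" "1 - b + a > 0" "1 - c + a > 0" "(1 - b) * (1 - c) \<le> a ^ 2" "a \<le> a'"
  shows "\<bar>well_poised_ratio a' b c k\<bar> \<le> \<bar>well_poised_ratio a b c k\<bar>"
proof -
  let ?f = "\<lambda>x. x / ((1 - b + x) * (1 - c + x))"
  have f: "\<bar>?f y\<bar> \<le> \<bar>?f x\<bar>" if "a \<le> x" "x \<le> y" for x y
  proof -
    have pos: "0 < x" "0 < y" "0 < 1 - b + x" "0 < 1 - b + y" "0 < 1 - c + x" "0 < 1 - c + y"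
      using that A by linarith+
    have "a ^ 2 \<le> x * y"
      using that A unfolding power2_eq_square by (intro mult_mono) auto
    with A(4) have "(1 - b) * (1 - c) - x * y \<le> 0"
      by linarith
    then have "(y - x) * ((1 - b) * (1 - c) - x * y) \<le> 0"
      using that by (intro mult_nonneg_nonpos) auto
    moreover have "y * ((1 - b + x) * (1 - c + x)) - x * ((1 - b + y) * (1 - c + y)) =
        (y - x) * ((1 - b) * (1 - c) - x * y)"
      by algebra
    ultimately have "y * ((1 - b + x) * (1 - c + x)) \<le> x * ((1 - b + y) * (1 - c + y))"
      by linarith
    then have "?f y \<le> ?f x"
      using pos by (subst frac_le_eq) (simp_all add: divide_nonpos_pos)
    then show ?thesis
      using pos by (simp add: abs_of_pos)
  qed
  have "(\<Prod>j<k. \<bar>?f (a' + real j)\<bar>) \<le> (\<Prod>j<k. \<bar>?f (a + real j)\<bar>)"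
    using A(5) by (intro prod_mono conjI f) auto
  moreover have "\<bar>1 + 2 * real k / a'\<bar> \<le> \<bar>1 + 2 * real k / a\<bar>"
    using A by (simp add: abs_of_nonneg divide_left_mono)
  ultimately show ?thesis
    unfolding well_poised_ratio_def abs_mult abs_prod by (intro mult_mono prod_nonneg) auto
qed

lemma well_poised_ratio_tendsto:
  "((\<lambda>a. well_poised_ratio a b c k) \<longlongrightarrow> (if k = 0 then 1 else 0)) at_top"
proof -
  have "((\<lambda>a. well_poised_ratio a b c k) \<longlongrightarrow>
      (-1) ^ k * pochhammer b k * pochhammer c k / fact k * 1 * (\<Prod>j<k. 0)) at_top"
    unfolding well_poised_ratio_def
  proof (intro tendsto_mult tendsto_prod tendsto_const)
    show "((\<lambda>a. 1 + 2 * real k / a) \<longlongrightarrow> 1) at_top"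
      by real_asymp
    show "((\<lambda>a. (a + real j) / ((1 - b + (a + real j)) * (1 - c + (a + real j)))) \<longlongrightarrow> 0) at_top"
      for j
      by real_asymp
  qed
  then show ?thesis
    by (cases k) auto
qed

lemma suminf_well_poised_ratio_tendsto:
  "\<forall>\<^sub>F a in at_top. summable (well_poised_ratio a b c)"
  "((\<lambda>a. suminf (well_poised_ratio a b c)) \<longlongrightarrow> 1) at_top"
proof -
  \<comment> \<open>This value is past the point where the ratios start to decrease, and it makes the series
    absolutely convergent.\<close>
  define a0 where "a0 = 1 + \<bar>1 - b\<bar> + \<bar>1 - c\<bar> + \<bar>2 * b + 2 * c\<bar>"
  have a0: "a0 > 0" "1 - b + a0 > 0" "1 - c + a0 > 0" "2 * b + 2 * c - a0 < 1"
    unfolding a0_def by linarith+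
  have "\<bar>1 - b\<bar> * \<bar>1 - c\<bar> \<le> a0 * a0"
    unfolding a0_def by (intro mult_mono) linarith+
  then have a0': "(1 - b) * (1 - c) \<le> a0 ^ 2"
    using abs_ge_self[of "(1 - b) * (1 - c)"] by (simp add: power2_eq_square abs_mult)
  define K where "K = a0 * rGamma (1 + a0 - b) * rGamma (1 + a0 - c)"
  have K: "K \<noteq> 0"
    using a0 unfolding K_def by (auto simp: rGamma_eq_zero_iff elim!: nonpos_Ints_cases)
  have "well_poised_coeff a0 b c k * (2 * real k + a0) = K * well_poised_ratio a0 b c k" for k
    unfolding K_def by (rule well_poised_coeff_eq_ratio) (use a0 in auto)
  with well_poised_coeff_summable[OF a0(4)] K have summable: "summable (\<lambda>k. \<bar>well_poised_ratio a0 b c k\<bar>)"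
    by (simp add: abs_mult)
  have "\<forall>\<^sub>F (k, a) in at_top \<times>\<^sub>F at_top. norm (well_poised_ratio a b c k) \<le> \<bar>well_poised_ratio a0 b c k\<bar>"
  proof -
    have "\<forall>\<^sub>F p in (at_top :: nat filter) \<times>\<^sub>F at_top. True \<and> a0 \<le> snd p"
      by (rule eventually_prodI) (auto simp: eventually_ge_at_top)
    then show ?thesis
      by eventually_elim (use a0 a0' in \<open>auto intro!: well_poised_ratio_antimono\<close>)
  qed
  from tannerys_theorem[OF well_poised_ratio_tendsto this summable trivial_limit_at_top_linorder]
  have *: "\<forall>\<^sub>F a in at_top. summable (\<lambda>k. norm (well_poised_ratio a b c k))"
    and **: "((\<lambda>a. \<Sum>k. well_poised_ratio a b c k) \<longlongrightarrow> (\<Sum>k. if k = 0 then 1 else 0)) at_top"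
    by auto
  show "\<forall>\<^sub>F a in at_top. summable (well_poised_ratio a b c)"
    using * by eventually_elim (rule summable_norm_cancel)
  show "((\<lambda>a. suminf (well_poised_ratio a b c)) \<longlongrightarrow> 1) at_top"
    using ** sums_single[of 0 "\<lambda>_. 1 :: real"] by (simp add: sums_iff)
qed

text \<open>
  For large \<open>N\<close> the recurrence expresses the series at \<open>a\<close> by the series at \<open>a + N\<close>. The
  resulting values \<open>S N\<close> all equal the same sum, and their limit can be computed: the powers of
  \<open>N\<close> that come from the Pochhammer symbols, from the reciprocal Gamma factors and from
  \<open>a + N\<close> cancel.
\<close>

theorem well_poised_sum:
  assumes conv: "2 * b + 2 * c - a < 2"
  shows "(\<lambda>k. well_poised_coeff a b c k * (2 * real k + a)) sums (rGamma a * rGamma (1 + a - b - c))"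
proof -
  let ?d = "1 + a - b - c"
  define S where "S N = pochhammer a N * pochhammer ?d N *
    ((a + real N) * rGamma (1 + (a + real N) - b) * rGamma (1 + (a + real N) - c) *
      suminf (well_poised_ratio (a + real N) b c))" for N
  have lim: "filterlim (\<lambda>N. a + real N) at_top sequentially"
    by real_asymp
  have "\<forall>\<^sub>F N in sequentially. summable (well_poised_ratio (a + real N) b c) \<and>
      a + real N > 0 \<and> 1 + (a + real N) - b > 0 \<and> 1 + (a + real N) - c > 0"
    by (intro eventually_conj eventually_compose_filterlim[OF suminf_well_poised_ratio_tendsto(1) lim])
       real_asymp+
  then have sums: "\<forall>\<^sub>F N in sequentially. (\<lambda>k. well_poised_coeff a b c k * (2 * real k + a)) sums S N"
  proof eventually_elim
    case (elim N)
    show ?case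
      unfolding S_def
    proof (rule well_poised_sums_shift[OF conv])
      show "(\<lambda>k. well_poised_coeff (a + real N) b c k * (2 * real k + (a + real N))) sums
          ((a + real N) * rGamma (1 + (a + real N) - b) * rGamma (1 + (a + real N) - c) *
            suminf (well_poised_ratio (a + real N) b c))"
        using elim by (subst well_poised_coeff_eq_ratio) (auto intro!: sums_mult summable_sums)
    qed
  qed
  let ?P = "\<lambda>x k. pochhammer x k / (fact k * real k powr (x - 1))"
  let ?Q = "\<lambda>z k. rGamma (z + real k) * (fact k * real k powr (z - 1))"
  have "(\<lambda>N. ?P a N * ?P ?d N * ?Q (1 + a - b) N * ?Q (1 + a - c) N * ((a + real N) / real N) *
      suminf (well_poised_ratio (a + real N) b c)) \<longlonglongrightarrow> rGamma a * rGamma ?d * 1 * 1 * 1 * 1"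
    by (intro tendsto_mult pochhammer_asymptotics rGamma_shift_asymptotics
        filterlim_compose[OF suminf_well_poised_ratio_tendsto(2) lim]) real_asymp
  moreover have "\<forall>\<^sub>F N in sequentially.
      ?P a N * ?P ?d N * ?Q (1 + a - b) N * ?Q (1 + a - c) N * ((a + real N) / real N) *
      suminf (well_poised_ratio (a + real N) b c) = S N"
    using eventually_gt_at_top[of 0]
  proof eventually_elim
    case (elim N)
    have powr: "real N powr (1 + a - b - 1) * real N powr (1 + a - c - 1) =
        real N powr (a - 1) * real N powr (?d - 1) * real N"
      using elim powr_add[of "real N" "2 * a - b - c - 1" 1]
      by (simp flip: powr_add add: algebra_simps)
    have regroup: "P / (F * A) * (Q / (F * B)) * (u * (F * D)) * (v * (F * E)) * (x / n) * s =
        P * Q * (x * u * v * s)"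
      if "D * E = A * B * n" "F \<noteq> 0" "A \<noteq> 0" "B \<noteq> 0" "n \<noteq> 0"
      for P Q F A B u v D E x s n :: real
    proof -
      have "P / (F * A) * (Q / (F * B)) * (u * (F * D)) * (v * (F * E)) * (x / n) * s =
          P * Q * u * v * x * s * (D * E) / (A * B * n)"
        using that(2-) by (simp add: field_simps)
      then show ?thesis
        unfolding that(1) using that(2-) by simp
    qed
    have args: "1 + (a + real N) - b = 1 + a - b + real N"
      "1 + (a + real N) - c = 1 + a - c + real N"
      by simp_all
    show ?case
      unfolding S_def args by (rule regroup[OF powr]) (use elim in simp_all)
  qed
  ultimately have limS: "S \<longlonglongrightarrow> rGamma a * rGamma ?d"
    by (auto dest: Lim_transform_eventually)
  from sums obtain s where s: "(\<lambda>k. well_poised_coeff a b c k * (2 * real k + a)) sums s"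
    by (auto simp: eventually_sequentially)
  have "\<forall>\<^sub>F N in sequentially. S N = s"
    using sums by eventually_elim (rule sums_unique2[OF _ s])
  then have "S \<longlonglongrightarrow> s"
    by (rule tendsto_eventually)
  with limS s show ?thesis
    using LIMSEQ_unique by blast
qed

section \<open>Specialisation to half-integers\<close>

lemma pochhammer_half_div_prod_odd:
  "pochhammer (1/2) k / (\<Prod>j=1..m. 2 * real k - 2 * real j + 1) =
     pochhammer (1/2 - real m) k / ((-2) ^ m * pochhammer (1/2) m)"
proof (induction m)
  case (Suc m)
  define x where "x = 1/2 - real (Suc m)"
  \<comment> \<open>No factor vanishes because all of them are odd integers.\<close>
  have "2 * k \<noteq> 2 * m + 1"
    by presburger
  then have "real (2 * k) \<noteq> real (2 * m + 1)"
    by (simp only: of_nat_eq_iff not_False_eq_True)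
  then have nz: "x + real k \<noteq> 0"
    unfolding x_def by simp
  have x: "x \<noteq> 0" "1/2 - real m = x + 1" "2 * real k - 2 * real (Suc m) + 1 = 2 * (x + real k)"
      "1/2 + real m = - x"
    unfolding x_def by (simp_all add: field_simps)
  have "x * pochhammer (x + 1) k = pochhammer x k * (x + real k)"
    by (metis pochhammer_rec pochhammer_Suc)
  then have "pochhammer (x + 1) k / (2 * (x + real k)) = pochhammer x k / (2 * x)"
    using nz x by (simp add: field_simps)
  have "pochhammer (1/2) k / (\<Prod>j=1..Suc m. 2 * real k - 2 * real j + 1) =
      (pochhammer (1/2) k / (\<Prod>j=1..m. 2 * real k - 2 * real j + 1)) / (2 * (x + real k))"
    by (simp only: prod.nat_ivl_Suc' x(3)) (simp add: mult_ac)
  also have "\<dots> = (pochhammer (x + 1) k / (2 * (x + real k))) / ((-2) ^ m * pochhammer (1/2) m)"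
    unfolding Suc.IH x(2) by simp
  also have "\<dots> = (pochhammer x k / (2 * x)) / ((-2) ^ m * pochhammer (1/2) m)"
    by (simp only: \<open>pochhammer (x + 1) k / (2 * (x + real k)) = pochhammer x k / (2 * x)\<close>)
  also have "\<dots> = pochhammer x k / ((-2) ^ Suc m * pochhammer (1/2) (Suc m))"
    unfolding pochhammer_Suc x(4) by simp
  finally show ?case
    unfolding x_def .
qed simp

lemma rGamma_half_minus:
  "rGamma (1/2 - real l) = (-1) ^ l * pochhammer (1/2) l / sqrt pi"
proof -
  have "pochhammer (1/2 - real l) l = (-1) ^ l * pochhammer (1/2) l"
    using pochhammer_minus'[of "-1/2 :: real" l] by (simp add: algebra_simps)
  then show ?thesis
    using pochhammer_rGamma[of "1/2 - real l" l]
    by (simp add: rGamma_inverse_Gamma Gamma_one_half_real field_simps)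
qed

lemma half_integer_sum:
  fixes l m n :: nat
  assumes "l \<le> 2 * m + 2 * n"
  shows "(\<lambda>k. (-1) ^ k / fact k ^ 3 *
           (pochhammer (1/2) k ^ 3 * (4 * real k + 1 - 2 * real l) /
            ((\<Prod>j=1..l. 2 * real k - 2 * real j + 1) *
             (\<Prod>j=1..m. 2 * real k - 2 * real j + 1) *
             (\<Prod>j=1..n. 2 * real k - 2 * real j + 1) *
             prod_upto (\<lambda>j. real k + real_of_int j) (int m - int l) *
             prod_upto (\<lambda>j. real k + real_of_int j) (int n - int l))))
      sums ((-1) ^ (m + n) /
            (pochhammer (1/2) m * pochhammer (1/2) n *
             gen_pochhammer (1/2) (real_of_int (int m + int n - int l)) *
             2 powi (int l + int m + int n - 1)) * (1 / pi))"
    (is "?t sums ?s")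
proof -
  let ?a = "1/2 - real l" and ?b = "1/2 - real m" and ?c = "1/2 - real n"
  define p where "p = (\<lambda>i. pochhammer (1/2 :: real) i)"
  \<comment> \<open>The 2 comes from \<open>4 k + 1 - 2 l = 2 (2 k + a)\<close>, the denominator from rewriting the three
    quotients of a Pochhammer symbol by a product of odd numbers.\<close>
  define K where "K = 2 / ((-2) ^ l * p l * ((-2) ^ m * p m) * ((-2) ^ n * p n))"
  have p: "p i > 0" for i
    unfolding p_def by (rule pochhammer_pos) simp
  have "real l \<le> real (2 * m + 2 * n)"
    using assms by (simp only: of_nat_le_iff)
  then have "2 * ?b + 2 * ?c - ?a < 2"
    by simp
  from sums_mult[OF well_poised_sum[OF this], of K]
  have "(\<lambda>k. K * (well_poised_coeff ?a ?b ?c k * (2 * real k + ?a))) sums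
      (K * (rGamma ?a * rGamma (1 + ?a - ?b - ?c)))" .
  moreover have "K * (well_poised_coeff ?a ?b ?c k * (2 * real k + ?a)) = ?t k" for k
  proof -
    let ?P = "\<lambda>i. \<Prod>j=1..i. 2 * real k - 2 * real j + 1"
    have q: "1 / prod_upto (\<lambda>j. real k + real_of_int j) (int i - int l) =
        fact k * rGamma (1 + ?a - (1/2 - real i) + real k)" for i
      unfolding inverse_prod_upto_plus using Gamma_fact[of k, where ?'a = real]
      by (simp add: algebra_simps)
    define X where "X = 2 * real k + ?a"
    have factor: "4 * real k + 1 - 2 * real l = 2 * X"
      by (simp add: X_def)
    have "?t k = (-1) ^ k / fact k ^ 3 * (2 * X) *
        (p k / ?P l) * (p k / ?P m) * (p k / ?P n) *
        (1 / prod_upto (\<lambda>j. real k + real_of_int j) (int m - int l)) *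
        (1 / prod_upto (\<lambda>j. real k + real_of_int j) (int n - int l))"
      unfolding p_def factor by (simp only: power3_eq_cube) (simp add: mult_ac)
    also have "\<dots> = K * (well_poised_coeff ?a ?b ?c k * (2 * real k + ?a))"
      unfolding q well_poised_coeff_def K_def X_def[symmetric]
      unfolding p_def pochhammer_half_div_prod_odd
      by (simp add: power3_eq_cube mult_ac)
    finally show ?thesis ..
  qed
  moreover have "K * (rGamma ?a * rGamma (1 + ?a - ?b - ?c)) = ?s"
  proof -
    define M where "M = real_of_int (int m + int n - int l)"
    have rG: "rGamma (1 + ?a - ?b - ?c) = 1 / (gen_pochhammer (1/2) M * sqrt pi)"
    proof -
      have arg: "1 + ?a - ?b - ?c = 1/2 + M"
        unfolding M_def by simp
      show ?thesis
        unfolding arg gen_pochhammer_def by (simp add: Gamma_one_half_real rGamma_inverse_Gamma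
            inverse_eq_divide)
    qed
    have two: "2 powi (int l + int m + int n - 1) = (2 :: real) ^ l * 2 ^ m * 2 ^ n / 2"
      by (simp add: power_int_diff power_add flip: of_nat_add)
    have neg: "(-2 :: real) ^ i = (-1) ^ i * 2 ^ i" for i
      by (simp flip: power_mult_distrib)
    have regroup: "2 / (s * d * pl * (t * e * pm) * (u * f * pn)) * (s * pl / r * (1 / (g * r))) =
        t * u / (pm * pn * g * (d * e * f / 2)) * (1 / (r * r))"
      if "s \<noteq> 0" "pl \<noteq> 0" "t * t = 1" "u * u = 1" for s t u d e f pl pm pn g r :: real
    proof -
      have "1 / t = t" "1 / u = u"
        using that(3,4) by (metis divide_eq_eq mult_zero_left zero_neq_one)+
      then have "t * u / (pm * pn * g * (d * e * f / 2)) * (1 / (r * r)) =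
          1 / t * (1 / u) / (pm * pn * g * (d * e * f / 2)) * (1 / (r * r))"
        by simp
      then show ?thesis
        using that(1,2) by (simp add: mult_ac)
    qed
    have "K * (rGamma ?a * rGamma (1 + ?a - ?b - ?c)) =
        (-1) ^ m * (-1) ^ n / (p m * p n * gen_pochhammer (1/2) M * (2 ^ l * 2 ^ m * 2 ^ n / 2)) *
        (1 / (sqrt pi * sqrt pi))"
      unfolding rG rGamma_half_minus K_def neg p_def[symmetric]
      by (rule regroup) (use p[of l] in \<open>simp_all flip: power_mult_distrib\<close>)
    also have "\<dots> = ?s"
      unfolding two M_def[symmetric] p_def[symmetric] by (simp add: power_add)
    finally show ?thesis .
  qed
  ultimately show ?thesis
    by simp
qed

lemma prod_upto_mult: "prod_upto (\<lambda>j. f j * g j) N = prod_upto f N * prod_upto g N"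
  by (simp add: prod_upto_def prod.distrib)

theorem corollary2:
  "(\<forall>l m n :: nat. l \<le> 2 * m + 2 * n \<longrightarrow>
      (\<lambda>k. (-1) ^ k / fact k ^ 3 *
           (pochhammer (1/2) k ^ 3 * (4 * real k + 1 - 2 * real l) /
            ((\<Prod>j=1..l. 2 * real k - 2 * real j + 1) *
             (\<Prod>j=1..m. 2 * real k - 2 * real j + 1) *
             (\<Prod>j=1..n. 2 * real k - 2 * real j + 1) *
             prod_upto (\<lambda>j. real k + real_of_int j) (int m - int l) *
             prod_upto (\<lambda>j. real k + real_of_int j) (int n - int l))))
      sums ((-1) ^ (m + n) /
            (pochhammer (1/2) m * pochhammer (1/2) n *
             gen_pochhammer (1/2) (real_of_int (int m + int n - int l)) *
             2 powi (int l + int m + int n - 1)) * (1 / pi))) \<and>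
   (\<forall>n :: nat.
      (\<lambda>k. (-1) ^ k * (pochhammer (1/2) k ^ 3 / fact k ^ 3) *
           ((4 * real k + 1) /
            (\<Prod>j=1..n. (2 * real k - 2 * real j + 1) * (real k + real j))))
      sums ((-1) ^ n / (pochhammer (1/2) n ^ 2 * 2 powi (int n - 1)) * (1 / pi))) \<and>
   (\<forall>n :: nat.
      (\<lambda>k. (-1) ^ k * (pochhammer (1/2) k ^ 3 / fact k ^ 3) *
           ((4 * real k + 1 - 2 * real n) /
            (\<Prod>j=1..n. (2 * real k - 2 * real j + 1) ^ 3)))
      sums (1 / (pochhammer (1/2) n ^ 3 * 2 powi (3 * int n - 1)) * (1 / pi))) \<and>
   (\<forall>m n :: nat.
      (\<lambda>k. (-1) ^ k * (pochhammer (1/2) k ^ 3 / fact k ^ 3) *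
           ((4 * real k + 1 - 2 * real m) /
            ((\<Prod>j=1..m. (2 * real k - 2 * real j + 1) ^ 2) *
             (\<Prod>j=1..n. 2 * real k - 2 * real j + 1) *
             prod_upto (\<lambda>j. real k + real_of_int j) (int n - int m))))
      sums ((-1) ^ (m + n) /
            (pochhammer (1/2) m * pochhammer (1/2) n ^ 2 * 2 powi (2 * int m + int n - 1)) *
            (1 / pi))) \<and>
   (\<forall>l n :: nat. l \<le> 4 * n \<longrightarrow>
      (\<lambda>k. (-1) ^ k * (pochhammer (1/2) k ^ 3 / fact k ^ 3) *
           ((4 * real k + 1 - 2 * real l) /
            ((\<Prod>j=1..l. 2 * real k - 2 * real j + 1) *
             (\<Prod>j=1..n. (2 * real k - 2 * real j + 1) ^ 2) *
             prod_upto (\<lambda>j. (real k + real_of_int j) ^ 2) (int n - int l))))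
      sums (1 / (gen_pochhammer (1/2) (real_of_int (2 * int n - int l)) *
                 pochhammer (1/2) n ^ 2 * 2 powi (2 * int n + int l - 1)) * (1 / pi)))"
proof (intro conjI allI impI half_integer_sum)
  have gen: "gen_pochhammer (1/2) (real n) = pochhammer (1/2) n" for n
    by (rule gen_pochhammer_of_nat) (auto elim!: nonpos_Ints_cases)
  have upto: "prod_upto (\<lambda>j. real k + real_of_int j) (int n) = (\<Prod>j=1..n. real k + real j)" for k n
    by (simp add: prod_upto_of_nat)
  have [simp]: "prod_upto f 0 = 1" for f :: "int \<Rightarrow> real"
    by (simp add: prod_upto_def)
  fix n :: nat
  show "(\<lambda>k. (-1) ^ k * (pochhammer (1/2) k ^ 3 / fact k ^ 3) *
           ((4 * real k + 1) /
            (\<Prod>j=1..n. (2 * real k - 2 * real j + 1) * (real k + real j))))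
      sums ((-1) ^ n / (pochhammer (1/2) n ^ 2 * 2 powi (int n - 1)) * (1 / pi))"
    using half_integer_sum[of 0 0 n]
    by (simp add: gen upto prod.distrib power2_eq_square mult_ac)
  show "(\<lambda>k. (-1) ^ k * (pochhammer (1/2) k ^ 3 / fact k ^ 3) *
           ((4 * real k + 1 - 2 * real n) /
            (\<Prod>j=1..n. (2 * real k - 2 * real j + 1) ^ 3)))
      sums (1 / (pochhammer (1/2) n ^ 3 * 2 powi (3 * int n - 1)) * (1 / pi))"
    using half_integer_sum[of n n n]
    by (simp add: gen prod.distrib power3_eq_cube mult_ac)
  show "(\<lambda>k. (-1) ^ k * (pochhammer (1/2) k ^ 3 / fact k ^ 3) *
           ((4 * real k + 1 - 2 * real m) /
            ((\<Prod>j=1..m. (2 * real k - 2 * real j + 1) ^ 2) *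
             (\<Prod>j=1..n. 2 * real k - 2 * real j + 1) *
             prod_upto (\<lambda>j. real k + real_of_int j) (int n - int m))))
      sums ((-1) ^ (m + n) /
            (pochhammer (1/2) m * pochhammer (1/2) n ^ 2 * 2 powi (2 * int m + int n - 1)) *
            (1 / pi))" for m
    using half_integer_sum[of m m n]
    by (simp add: gen prod.distrib power2_eq_square mult_ac)
  show "(\<lambda>k. (-1) ^ k * (pochhammer (1/2) k ^ 3 / fact k ^ 3) *
           ((4 * real k + 1 - 2 * real l) /
            ((\<Prod>j=1..l. 2 * real k - 2 * real j + 1) *
             (\<Prod>j=1..n. (2 * real k - 2 * real j + 1) ^ 2) *
             prod_upto (\<lambda>j. (real k + real_of_int j) ^ 2) (int n - int l))))
      sums (1 / (gen_pochhammer (1/2) (real_of_int (2 * int n - int l)) *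
                 pochhammer (1/2) n ^ 2 * 2 powi (2 * int n + int l - 1)) * (1 / pi))"
    if "l \<le> 4 * n" for l
    using half_integer_sum[of l n n] that
    by (simp add: prod_upto_mult prod.distrib power2_eq_square mult_ac)
qed

end
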